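(* Let $m\ge 3$ and $n\ge 3$ be integers. Then $$\chi_{\rho}(K_m, K_n) = mn - 2m + 2\,.$$
   Context: For graphs $G$ and $H$ and a function $f\colon V(G)\to V(H)$, the Sierpiński product $G\otimes_f H$ is the graph with vertex set $V(G)\times V(H)$ whose edges are: $(g,h)(g,h')$ for every $g\in V(G)$ and every edge $hh'\in E(H)$; and $(g,f(g'))(g',f(g))$ for every edge $gg'\in E(G)$. Let $H^G$ denote the set of all functions $V(G)\to V(H)$. For a graph $X$, a packing $k$-coloring is a map $c\colon V(X)\to\{1,\dots,k\}$ such that whenever $u\neq v$ and $c(u)=c(v)=\ell$, the shortest-path distance satisfies $d_X(u,v)>\ell$; the packing chromatic number $\chi_\rho(X)$ is the least $k$ for which a packing $k$-coloring exists. The Sierpiński packing chromatic number of the pair $(G,H)$ is $\chi_\rho(G,H)=\min_{f\in H^G}\chi_\rho(G\otimes_f H)$. $K_m$ denotes the complete graph on $m$ vertices. *)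

theory Defs
  imports Main "HOL-Library.FuncSet" "HOL-Library.Extended_Nat"
begin

record 'a ugraph =
  verts :: "'a set"
  edges :: "'a set set"

definition simple_graph :: "'a ugraph \<Rightarrow> bool" where
  "simple_graph X \<longleftrightarrow> edges X \<subseteq> {{u, v} | u v. u \<in> verts X \<and> v \<in> verts X \<and> u \<noteq> v}"

definition complete_graph :: "nat \<Rightarrow> nat ugraph" where
  "complete_graph m =
     \<lparr>verts = {..<m}, edges = {{u, v} | u v. u \<in> {..<m} \<and> v \<in> {..<m} \<and> u \<noteq> v}\<rparr>"

text \<open>A path is given by its nonempty list of pairwise distinct vertices; its length (number of
  edges) is the length of the list minus 1.\<close>

definition path_between :: "'a ugraph \<Rightarrow> 'a \<Rightarrow> 'a list \<Rightarrow> 'a \<Rightarrow> bool" where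
  "path_between X u p v \<longleftrightarrow>
     p \<noteq> [] \<and> hd p = u \<and> last p = v \<and> distinct p \<and> set p \<subseteq> verts X \<and>
     (\<forall>i. Suc i < length p \<longrightarrow> {p ! i, p ! Suc i} \<in> edges X)"

text \<open>The distance is \<open>\<infinity>\<close> when no path exists, since the infimum of the empty set in
  \<^typ>\<open>enat\<close> is \<open>\<infinity>\<close>.\<close>

definition graph_dist :: "'a ugraph \<Rightarrow> 'a \<Rightarrow> 'a \<Rightarrow> enat" where
  "graph_dist X u v = (INF p \<in> {p. path_between X u p v}. enat (length p - 1))"

definition packing_coloring :: "'a ugraph \<Rightarrow> nat \<Rightarrow> ('a \<Rightarrow> nat) \<Rightarrow> bool" where
  "packing_coloring X k c \<longleftrightarrow>
     c \<in> verts X \<rightarrow> {1..k} \<and>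
     (\<forall>u \<in> verts X. \<forall>v \<in> verts X. u \<noteq> v \<and> c u = c v \<longrightarrow> graph_dist X u v > enat (c u))"

text \<open>Meaningful for finite graphs, which always have a packing coloring (see
  \<open>ex_packing_coloring\<close> below).\<close>

definition packing_chromatic_number :: "'a ugraph \<Rightarrow> nat" where
  "packing_chromatic_number X = (LEAST k. \<exists>c. packing_coloring X k c)"

definition sierpinski_product ::
  "'a ugraph \<Rightarrow> ('a \<Rightarrow> 'b) \<Rightarrow> 'b ugraph \<Rightarrow> ('a \<times> 'b) ugraph" where
  "sierpinski_product G f H =
     \<lparr>verts = verts G \<times> verts H,
      edges = {{(g, h), (g, h')} | g h h'. g \<in> verts G \<and> {h, h'} \<in> edges H} \<union>
              {{(g, f g'), (g', f g)} | g g'. {g, g'} \<in> edges G}\<rparr>"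

text \<open>The functions from \<open>V(G)\<close> to \<open>V(H)\<close> are the extensional ones, so that for finite graphs
  there are finitely many of them and \<^const>\<open>Min\<close> is a genuine minimum.\<close>

definition sierpinski_packing_chromatic_number :: "'a ugraph \<Rightarrow> 'b ugraph \<Rightarrow> nat" where
  "sierpinski_packing_chromatic_number G H =
     Min ((\<lambda>f. packing_chromatic_number (sierpinski_product G f H)) ` (verts G \<rightarrow>\<^sub>E verts H))"

lemma simple_graph_complete_graph: "simple_graph (complete_graph m)"
  by (auto simp: simple_graph_def complete_graph_def)

lemma simple_graph_sierpinski_product:
  assumes G: "simple_graph G" and H: "simple_graph H" and f: "f \<in> verts G \<rightarrow> verts H"
  shows "simple_graph (sierpinski_product G f H)"
proof -
  have *: "u \<in> verts X \<and> v \<in> verts X \<and> u \<noteq> v"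
    if X: "simple_graph X" and uv: "{u, v} \<in> edges X" for X :: "'c ugraph" and u v
    using X uv unfolding simple_graph_def by (fastforce simp: doubleton_eq_iff)
  show ?thesis
    unfolding simple_graph_def
  proof
    fix e assume "e \<in> edges (sierpinski_product G f H)"
    then consider g h h' where "e = {(g, h), (g, h')}" "g \<in> verts G" "{h, h'} \<in> edges H"
      | g g' where "e = {(g, f g'), (g', f g)}" "{g, g'} \<in> edges G"
      by (auto simp: sierpinski_product_def)
    then show "e \<in> {{u, v} | u v. u \<in> verts (sierpinski_product G f H) \<and>
                 v \<in> verts (sierpinski_product G f H) \<and> u \<noteq> v}"
    proof cases
      case 1
      show ?thesis
        by (rule CollectI, rule exI[of _ "(g, h)"], rule exI[of _ "(g, h')"])
          (use 1 *[OF H 1(3)] in \<open>auto simp: sierpinski_product_def\<close>)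
    next
      case 2
      have gg: "g \<in> verts G" "g' \<in> verts G" "g \<noteq> g'" using *[OF G 2(2)] by auto
      then have "f g \<in> verts H" "f g' \<in> verts H" using f by auto
      with gg 2(1) show ?thesis
        by (intro CollectI exI[of _ "(g, f g')"] exI[of _ "(g', f g)"])
          (auto simp: sierpinski_product_def)
    qed
  qed
qed

lemma ex_packing_coloring:
  assumes "finite (verts X)"
  shows "\<exists>k c. packing_coloring X k c"
proof -
  obtain c :: "'a \<Rightarrow> nat" and n where c: "c ` verts X = {i. i < n}" "inj_on c (verts X)"
    using finite_imp_inj_to_nat_seg[OF assms] by blast
  then have "packing_coloring X n (\<lambda>v. Suc (c v))"
    unfolding packing_coloring_def by (auto simp: inj_on_def Suc_le_eq)
  then show ?thesis by blast
qed

end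

theory Submission
  imports Defs
begin

text \<open>In a Sierpinski product of complete graphs, each copy of \<open>K\<^sub>n\<close> is a clique, so a color is
  used at most once per copy; and any two vertices are joined by a path of length at most 3
  through the edge connecting their copies, so each color \<open>\<ge> 3\<close> is used at most once. Hence
  \<open>m n \<le> 2 m + (k - 2)\<close>. For constant \<open>f = 0\<close> this is attained: vertices
  \<open>(g, a)\<close> and \<open>(g', a)\<close> with \<open>a \<noteq> 0\<close> in distinct copies are at distance 3, so colors 1 and 2
  can each be used in every copy, on \<open>a = 1\<close> and \<open>a = 2\<close>.\<close>

lemma verts_complete_graph: "verts (complete_graph m) = {..<m}"
  by (simp add: complete_graph_def)

lemma verts_sierpinski_complete:
  "verts (sierpinski_product (complete_graph m) f (complete_graph n)) = {..<m} \<times> {..<n}"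
  by (simp add: sierpinski_product_def verts_complete_graph)

lemma edge_complete_graph_iff:
  "{u, v} \<in> edges (complete_graph m) \<longleftrightarrow> u < m \<and> v < m \<and> u \<noteq> v"
  by (auto simp: complete_graph_def doubleton_eq_iff)

lemma edge_sierpinski_complete_iff:
  "{(g, h), (g', h')} \<in> edges (sierpinski_product (complete_graph m) f (complete_graph n)) \<longleftrightarrow>
     g = g' \<and> g < m \<and> h < n \<and> h' < n \<and> h \<noteq> h' \<or>
     g \<noteq> g' \<and> g < m \<and> g' < m \<and> h = f g' \<and> h' = f g"
  unfolding sierpinski_product_def
  by (auto simp: edge_complete_graph_iff verts_complete_graph doubleton_eq_iff)

lemma graph_dist_le:
  assumes "path_between X u p v" and "length p \<le> Suc k"
  shows "graph_dist X u v \<le> enat k"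
proof -
  have "graph_dist X u v \<le> enat (length p - 1)"
    unfolding graph_dist_def using assms(1) by (intro INF_lower) simp
  also have "\<dots> \<le> enat k" using assms(2) by simp
  finally show ?thesis .
qed

lemma graph_dist_sierpinski_same_copy:
  assumes "g < m" and "h < n" and "h' < n" and "h \<noteq> h'"
  shows "graph_dist (sierpinski_product (complete_graph m) f (complete_graph n)) (g, h) (g, h') \<le> 1"
proof -
  have "path_between (sierpinski_product (complete_graph m) f (complete_graph n))
          (g, h) [(g, h), (g, h')] (g, h')"
    using assms
    by (simp add: path_between_def verts_sierpinski_complete edge_sierpinski_complete_iff)
  from graph_dist_le[OF this, of 1] show ?thesis by (simp add: one_enat_def)
qed

lemma graph_dist_sierpinski_distinct_copies:
  assumes "g < m" and "g' < m" and "g \<noteq> g'" and "h < n" and "h' < n"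
    and f: "f \<in> {..<m} \<rightarrow> {..<n}"
  shows "graph_dist (sierpinski_product (complete_graph m) f (complete_graph n)) (g, h) (g', h') \<le> 3"
proof -
  \<comment> \<open>Cross the edge joining the two copies, with one step inside each copy at most.
    An endpoint already on that edge is dropped, since \<open>path_between\<close> demands distinct
    vertices.\<close>
  define p where "p = (if h = f g' then [] else [(g, h)]) @ [(g, f g'), (g', f g)] @
    (if h' = f g then [] else [(g', h')])"
  have "f g < n" "f g' < n" using assms by auto
  then have "path_between (sierpinski_product (complete_graph m) f (complete_graph n))
          (g, h) p (g', h')"
    using assms
    by (auto simp: path_between_def p_def verts_sierpinski_complete edge_sierpinski_complete_iff
          nth_Cons less_Suc_eq split: nat.splits)
  moreover have "length p \<le> Suc 3" by (simp add: p_def)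
  ultimately show ?thesis using graph_dist_le by (metis numeral_eq_enat)
qed

text \<open>The lower bound, uniform in \<open>f\<close>. The additive form avoids truncated
  subtraction.\<close>

lemma packing_coloring_sierpinski_complete_ge:
  assumes f: "f \<in> {..<m} \<rightarrow> {..<n}" and m: "m \<ge> 1" and n: "n \<ge> 3"
    and c: "packing_coloring (sierpinski_product (complete_graph m) f (complete_graph n)) k c"
  shows "m * n + 2 \<le> 2 * m + k"
proof -
  let ?X = "sierpinski_product (complete_graph m) f (complete_graph n)"
  define V where "V = {..<m} \<times> {..<n}"
  have V: "verts ?X = V" by (simp add: V_def verts_sierpinski_complete)
  have range: "1 \<le> c v \<and> c v \<le> k" if "v \<in> V" for v
    using c that by (auto simp: packing_coloring_def V)
  have dist: "enat (c u) < graph_dist ?X u v"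
    if "u \<in> V" "v \<in> V" "u \<noteq> v" "c u = c v" for u v
    using c that unfolding packing_coloring_def V by blast
  have inj_fst: "inj_on fst {v \<in> V. c v = i}" for i
  proof (rule inj_onI, rule ccontr)
    fix u v assume uv: "u \<in> {v \<in> V. c v = i}" "v \<in> {v \<in> V. c v = i}" "fst u = fst v" "u \<noteq> v"
    then have "graph_dist ?X u v \<le> 1"
      using graph_dist_sierpinski_same_copy[of "fst u" m "snd u" n "snd v" f]
      by (auto simp: V_def prod_eq_iff)
    moreover have "1 \<le> enat (c u)" using range[of u] uv by (simp add: one_enat_def)
    moreover have "enat (c u) < graph_dist ?X u v" using dist[of u v] uv by simp
    ultimately show False by order
  qed
  have fiber: "card {v \<in> V. c v = i} \<le> m" for i
  proof -
    have "card {v \<in> V. c v = i} \<le> card {..<m}"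
      using inj_fst by (rule card_inj_on_le) (auto simp: V_def)
    then show ?thesis by simp
  qed
  have "inj_on c {v \<in> V. 3 \<le> c v}"
  proof (rule inj_onI, rule ccontr)
    fix u v assume uv: "u \<in> {v \<in> V. 3 \<le> c v}" "v \<in> {v \<in> V. 3 \<le> c v}" "c u = c v" "u \<noteq> v"
    then have less: "enat (c u) < graph_dist ?X u v" using dist by auto
    \<comment> \<open>Equal colors within one copy are already excluded, so the bound 3 for distinct
      copies applies.\<close>
    have "fst u \<noteq> fst v" using inj_onD[OF inj_fst[of "c u"], of u v] uv by auto
    then have "graph_dist ?X u v \<le> 3"
      using graph_dist_sierpinski_distinct_copies[OF _ _ _ _ _ f, of "fst u" "fst v" "snd u" "snd v"] uv
      by (auto simp: V_def)
    moreover have "3 \<le> enat (c u)" using uv by (simp add: numeral_eq_enat)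
    ultimately show False using less by order
  qed
  then have "card {v \<in> V. 3 \<le> c v} \<le> card {3..k}"
    by (rule card_inj_on_le) (use range in auto)
  moreover have "card V \<le> card {v \<in> V. c v = 1} + card {v \<in> V. c v = 2} + card {v \<in> V. 3 \<le> c v}"
  proof -
    have "V = {v \<in> V. c v = 1} \<union> {v \<in> V. c v = 2} \<union> {v \<in> V. 3 \<le> c v}"
      using range by force
    then show ?thesis by (metis (no_types, lifting) add_le_mono1 card_Un_le le_trans)
  qed
  ultimately have "m * n \<le> 2 * m + (k - 2)"
    using fiber[of 1] fiber[of 2] by (simp add: V_def card_cartesian_product)
  \<comment> \<open>Rules out \<open>k < 2\<close>, where \<open>k - 2\<close> truncates to 0: then
    \<open>m * n \<le> 2 * m\<close>, contradicting \<open>3 * m \<le> m * n\<close> with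
    \<open>m \<ge> 1\<close>.\<close>
  moreover have "m * 3 \<le> m * n" using n by simp
  ultimately show ?thesis using m by linarith
qed

text \<open>All edges between copies join vertices with second coordinate 0. A path must therefore
  step to 0 in its first copy, cross, and step away from 0 in its last copy. If no path exists, the
  distance is infinite.\<close>

lemma graph_dist_constant_sierpinski_complete_gt:
  assumes f: "\<And>g. g < m \<Longrightarrow> f g = 0" and a: "a \<noteq> 0" and g: "g \<noteq> g'"
  shows "enat 2 < graph_dist (sierpinski_product (complete_graph m) f (complete_graph n)) (g, a) (g', a)"
    (is "_ < graph_dist ?X _ _")
proof -
  have "3 \<le> length p - 1" if p: "path_between ?X (g, a) p (g', a)" for p
  proof (rule ccontr)
    assume "\<not> 3 \<le> length p - 1"
    moreover have "p \<noteq> []" "hd p = (g, a)" "last p = (g', a)"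
      and e: "\<And>i. Suc i < length p \<Longrightarrow> {p ! i, p ! Suc i} \<in> edges ?X"
      using p by (auto simp: path_between_def)
    ultimately consider "p = [(g, a), (g', a)]" | x b where "p = [(g, a), (x, b), (g', a)]"
      using g by (cases p; cases "tl p"; cases "tl (tl p)"; cases "tl (tl (tl p))") auto
    then show False
    proof cases
      case 1
      with e[of 0] f a g show False by (auto simp: edge_sierpinski_complete_iff)
    next
      case 2
      \<comment> \<open>The first edge cannot leave copy \<open>g\<close> because
        \<open>a \<noteq> 0\<close>, so \<open>x = g\<close>; the second edge then changes copy and
        would force \<open>a = f g = 0\<close>.\<close>
      with e[of 0] e[of 1] f a g show False by (auto simp: edge_sierpinski_complete_iff)
    qed
  qed
  then have "enat 3 \<le> graph_dist ?X (g, a) (g', a)"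
    unfolding graph_dist_def by (intro INF_greatest) simp
  moreover have "enat 2 < enat 3" by simp
  ultimately show ?thesis by order
qed

lemma ex_packing_coloring_constant_sierpinski_complete:
  assumes f: "\<And>g. g < m \<Longrightarrow> f g = 0" and n: "n \<ge> 3"
  shows "\<exists>c. packing_coloring (sierpinski_product (complete_graph m) f (complete_graph n))
           (m * (n - 2) + 2) c"
proof -
  let ?X = "sierpinski_product (complete_graph m) f (complete_graph n)"
  \<comment> \<open>The vertices that receive a color of their own; the excluded second coordinates
    1 and 2 serve as colors themselves.\<close>
  define R where "R = {..<m} \<times> ({..<n} - {1, 2})"
  have "card ({..<n} - {1, 2}) = n - 2"
    using n by (subst card_Diff_subset) auto
  then have "card R = m * (n - 2)"
    by (simp add: R_def card_cartesian_product)
  moreover have "finite R" by (simp add: R_def)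
  ultimately obtain e where e: "bij_betw e R {0..<m * (n - 2)}"
    using ex_bij_betw_finite_nat by metis
  \<comment> \<open>Since \<open>e\<close> counts from 0, the private colors run from 3 to
    \<open>m * (n - 2) + 2\<close>.\<close>
  define c where "c = (\<lambda>(g, h). if h = 1 \<or> h = 2 then h else 3 + e (g, h))"
  have e_less: "e v < m * (n - 2)" if "v \<in> R" for v
    using bij_betwE[OF e] that by auto
  have "packing_coloring ?X (m * (n - 2) + 2) c"
    unfolding packing_coloring_def verts_sierpinski_complete
  proof (intro conjI ballI impI)
    show "c \<in> {..<m} \<times> {..<n} \<rightarrow> {1..m * (n - 2) + 2}"
    proof
      fix v assume v: "v \<in> {..<m} \<times> {..<n}"
      show "c v \<in> {1..m * (n - 2) + 2}"
        using v e_less[of v] by (cases v) (auto simp: c_def R_def)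
    qed
  next
    fix u v assume u: "u \<in> {..<m} \<times> {..<n}" and v: "v \<in> {..<m} \<times> {..<n}"
      and uv: "u \<noteq> v \<and> c u = c v"
    obtain g a g' b where [simp]: "u = (g, a)" "v = (g', b)" by (cases u, cases v) auto
    show "enat (c u) < graph_dist ?X u v"
    proof (cases "a = 1 \<or> a = 2")
      case True
      with uv have b: "b = a" and "g \<noteq> g'"
        by (auto simp: c_def split: if_splits)
      with graph_dist_constant_sierpinski_complete_gt[of m f a g g' n] f True
      \<comment> \<open>One bound settles both repeated colors, as
        \<open>c u \<le> 2\<close>.\<close>
      have "enat 2 < graph_dist ?X u v" by auto
      moreover have "enat (c u) \<le> enat 2" using True by (auto simp: c_def)
      ultimately show ?thesis by order
    next
      case False
      with uv have "u \<in> R" "v \<in> R" "e u = e v"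
        using u v by (auto simp: c_def R_def split: if_splits)
      with uv bij_betw_imp_inj_on[OF e] show ?thesis by (auto dest: inj_onD)
    qed
  qed
  then show ?thesis by blast
qed

theorem theorem3p4:
  fixes m n :: nat
  assumes "m \<ge> 3" and "n \<ge> 3"
  shows "int (sierpinski_packing_chromatic_number (complete_graph m) (complete_graph n))
           = int m * int n - 2 * int m + 2"
proof -
  let ?X = "\<lambda>f. sierpinski_product (complete_graph m) f (complete_graph n)"
  let ?F = "{..<m} \<rightarrow>\<^sub>E {..<n}"
  let ?chi = "\<lambda>f. packing_chromatic_number (?X f)"
  define K where "K = m * (n - 2) + 2"
  have K: "K + 2 * m = m * n + 2"
    using assms(2) by (simp add: K_def diff_mult_distrib2)
  have lower: "K \<le> ?chi f" if "f \<in> ?F" for f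
  proof -
    \<comment> \<open>Existence makes the \<open>LEAST\<close> an attained value, so the counting
      bound can be applied to an optimal coloring.\<close>
    have "\<exists>k c. packing_coloring (?X f) k c"
      by (rule ex_packing_coloring) (simp add: verts_sierpinski_complete)
    then have "\<exists>c. packing_coloring (?X f) (?chi f) c"
      unfolding packing_chromatic_number_def by (rule LeastI_ex)
    then obtain c where "packing_coloring (?X f) (?chi f) c" by blast
    with packing_coloring_sierpinski_complete_ge[of f m n] that assms
    have "m * n + 2 \<le> 2 * m + ?chi f" by (auto simp: PiE_def)
    with K show ?thesis by linarith
  qed
  \<comment> \<open>The constant map 0, restricted so as to lie in the extensional function space
    over which \<open>Min\<close> ranges.\<close>
  define f0 :: "nat \<Rightarrow> nat" where "f0 = restrict (\<lambda>_. 0) {..<m}"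
  have f0: "f0 \<in> ?F" using assms by (auto simp: f0_def)
  have "?chi f0 \<le> K"
    unfolding packing_chromatic_number_def K_def
    by (intro Least_le ex_packing_coloring_constant_sierpinski_complete)
      (use assms in \<open>auto simp: f0_def\<close>)
  with lower[OF f0] have "K = ?chi f0" by simp
  with f0 have "K \<in> ?chi ` ?F" by blast
  moreover have "finite ?F" by (simp add: finite_PiE)
  ultimately have "Min (?chi ` ?F) = K"
    using lower by (intro Min_eqI) auto
  then have "sierpinski_packing_chromatic_number (complete_graph m) (complete_graph n) = K"
    by (simp add: sierpinski_packing_chromatic_number_def verts_complete_graph)
  with K show ?thesis by (simp add: algebra_simps flip: of_nat_mult of_nat_add)
qed

end
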